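(* Let $R$ be an integral domain and $S$ a saturated multiplicatively closed subset of $R$. Then $S$ is a splitting multiplicative set if and only if $S$ splits $R$ (where $R$ is regarded as a module over itself).
   Context: All rings are commutative with identity and all modules are unitary and nonzero. $U(R)$ is the set of units of a ring $R$. A multiplicatively closed subset $S$ of $R$ (containing $1$) is saturated if $xy\in S$ implies $x,y\in S$; $S$ may contain $0$, which means $S=R$. Splitting multiplicative set: a saturated multiplicatively closed subset $S$ of a domain $R$ such that for each $x\in R$ one can write $x=as$ with $a\in R$, $s\in S$ such that $aR\cap tR=atR$ for all $t\in S$. Let $M$ be an $R$-module and $S$ a saturated multiplicatively closed subset of $R$. For $m,n\in M$ write $m\sim^S n$ if there are $s,s'\in S$ with $m=sn$ and $n=s'm$; for $S=R$ write $\sim$ (in particular, for $a,b\in R$, $a\sim b$ means $aR=bR$). An element $m\in M$ is $S$-primitive if $m=sn$ with $s\in S$, $n\in M$ implies $n\sim^S m$. A compact $S$-atomic factorization of $m\in M$ is an equation $m=sn$ with $s\in S$ and $n\in M$ $S$-primitive. A subset $E\subseteq M$ is compactly $S$-atomic if every nonzero element of $E$ has a compact $S$-atomic factorization. $E$ is semi-$S$-factorable if it is compactly $S$-atomic and for every $0\neq m\in E$ and compact $S$-atomic factorizations $m=sn=s'n'$ one has $s\sim s'$. $S$ splits $E$ if (1) $E$ is semi-$S$-factorable, and (2) for every $S$-primitive $r\in R$ (i.e. $S$-primitive in the $R$-module $R$) and every $S$-primitive $m\in M$ with $0\neq rm\in E$, the element $rm$ is $S$-primitive. Here these notions are applied with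 $M=E=R$. *)

theory Defs
  imports Complex_Main
begin

text \<open>
  The notions below are relative to an \<open>R\<close>-module \<open>M\<close>, with \<open>R\<close> the type \<open>'a\<close>, \<open>M\<close> the type
  \<open>'b\<close> and \<open>scale\<close> the scalar multiplication, meant to satisfy \<^locale>\<open>module\<close>. The ring \<open>R\<close>,
  regarded as a module over itself, is the instance \<open>scale = (*)\<close>.
\<close>

lemma module_self: "module ((*) :: 'a::comm_ring_1 \<Rightarrow> 'a \<Rightarrow> 'a)"
  by unfold_locales (simp_all add: algebra_simps)

definition saturated_mult_set :: "'a::comm_ring_1 set \<Rightarrow> bool"
  where "saturated_mult_set S \<longleftrightarrow>
    1 \<in> S \<and> (\<forall>x\<in>S. \<forall>y\<in>S. x * y \<in> S) \<and> (\<forall>x y. x * y \<in> S \<longrightarrow> x \<in> S \<and> y \<in> S)"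

definition principal_ideal :: "'a::comm_ring_1 \<Rightarrow> 'a set"
  where "principal_ideal a = range ((*) a)"

text \<open>The case \<open>0 \<in> S\<close>, that is \<open>S = UNIV\<close>, is allowed.\<close>

definition splitting_mult_set :: "'a::idom set \<Rightarrow> bool"
  where "splitting_mult_set S \<longleftrightarrow> saturated_mult_set S \<and>
    (\<forall>x. \<exists>a s. s \<in> S \<and> x = a * s \<and>
      (\<forall>t\<in>S. principal_ideal a \<inter> principal_ideal t = principal_ideal (a * t)))"

definition S_assoc ::
    "'a::comm_ring_1 set \<Rightarrow> ('a \<Rightarrow> 'b::ab_group_add \<Rightarrow> 'b) \<Rightarrow> 'b \<Rightarrow> 'b \<Rightarrow> bool"
  where "S_assoc S scale m n \<longleftrightarrow> (\<exists>s\<in>S. \<exists>s'\<in>S. m = scale s n \<and> n = scale s' m)"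

definition S_primitive ::
    "'a::comm_ring_1 set \<Rightarrow> ('a \<Rightarrow> 'b::ab_group_add \<Rightarrow> 'b) \<Rightarrow> 'b \<Rightarrow> bool"
  where "S_primitive S scale m \<longleftrightarrow>
    (\<forall>s\<in>S. \<forall>n. m = scale s n \<longrightarrow> S_assoc S scale n m)"

definition compact_S_atomic_factorization ::
    "'a::comm_ring_1 set \<Rightarrow> ('a \<Rightarrow> 'b::ab_group_add \<Rightarrow> 'b) \<Rightarrow> 'b \<Rightarrow> 'a \<Rightarrow> 'b \<Rightarrow> bool"
  where "compact_S_atomic_factorization S scale m s n \<longleftrightarrow>
    m = scale s n \<and> s \<in> S \<and> S_primitive S scale n"

definition compactly_S_atomic ::
    "'a::comm_ring_1 set \<Rightarrow> ('a \<Rightarrow> 'b::ab_group_add \<Rightarrow> 'b) \<Rightarrow> 'b set \<Rightarrow> bool"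
  where "compactly_S_atomic S scale E \<longleftrightarrow>
    (\<forall>m\<in>E. m \<noteq> 0 \<longrightarrow> (\<exists>s n. compact_S_atomic_factorization S scale m s n))"

text \<open>
  The relation \<open>s \<sim> s'\<close> between the scalars is association in \<open>R\<close> itself, with respect to all
  of \<open>R\<close> and not just \<open>S\<close>.
\<close>

definition semi_S_factorable ::
    "'a::comm_ring_1 set \<Rightarrow> ('a \<Rightarrow> 'b::ab_group_add \<Rightarrow> 'b) \<Rightarrow> 'b set \<Rightarrow> bool"
  where "semi_S_factorable S scale E \<longleftrightarrow> compactly_S_atomic S scale E \<and>
    (\<forall>m\<in>E. m \<noteq> 0 \<longrightarrow> (\<forall>s n s' n'.
      compact_S_atomic_factorization S scale m s n \<longrightarrow>
      compact_S_atomic_factorization S scale m s' n' \<longrightarrow>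
      S_assoc UNIV (*) s s'))"

definition splits ::
    "'a::comm_ring_1 set \<Rightarrow> ('a \<Rightarrow> 'b::ab_group_add \<Rightarrow> 'b) \<Rightarrow> 'b set \<Rightarrow> bool"
  where "splits S scale E \<longleftrightarrow> semi_S_factorable S scale E \<and>
    (\<forall>r m. S_primitive S (*) r \<longrightarrow> S_primitive S scale m \<longrightarrow>
      scale r m \<noteq> 0 \<longrightarrow> scale r m \<in> E \<longrightarrow> S_primitive S scale (scale r m))"

end

theory Submission imports Defs begin

text \<open>
  Call \<open>a \<noteq> 0\<close> prime to \<open>S\<close> if every \<open>t \<in> S\<close> dividing a multiple \<open>a * y\<close> already divides \<open>y\<close>;
  this is the condition on \<open>a\<close> in the definition of a splitting multiplicative set. An element
  prime to \<open>S\<close> is always \<open>S\<close>-primitive. If \<open>S\<close> is a splitting set, the converse holds for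
  nonzero elements; uniqueness of the \<open>S\<close>-part and closure of primitives under products are then
  cancellation. If instead \<open>S\<close> splits \<open>R\<close>, let \<open>n\<close> be primitive and \<open>n * y = t * z \<noteq> 0\<close> with
  \<open>t \<in> S\<close>. Factor \<open>y = u * y'\<close> and \<open>z = v * z'\<close> compactly; as \<open>n * y'\<close> is primitive,
  \<open>u * (n * y') = (t * v) * z'\<close> are two compact factorizations, so \<open>t\<close> divides \<open>u\<close>, hence \<open>y\<close>.
\<close>

text \<open>Zero is not excluded: \<open>prime_to S 0\<close> says that every element of
  \<open>S\<close> is a unit.\<close>

definition prime_to :: "'a::comm_ring_1 set \<Rightarrow> 'a \<Rightarrow> bool"
  where "prime_to S a \<longleftrightarrow> (\<forall>t\<in>S. \<forall>y. t dvd a * y \<longrightarrow> t dvd y)"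

lemma prime_toD: "prime_to S a \<Longrightarrow> t \<in> S \<Longrightarrow> t dvd a * y \<Longrightarrow> t dvd y"
  unfolding prime_to_def by blast

lemma prime_to_mult:
  assumes "prime_to S a" "prime_to S b"
  shows "prime_to S (a * b)"
  unfolding prime_to_def
proof (intro ballI allI impI)
  fix t y assume t: "t \<in> S" and "t dvd a * b * y"
  then have "t dvd b * y"
    using prime_toD[OF assms(1) t, of "b * y"] by (simp only: mult.assoc)
  then show "t dvd y"
    by (rule prime_toD[OF assms(2) t])
qed

lemma prime_to_dvd:
  assumes "prime_to S a" "b dvd a"
  shows "prime_to S b"
  unfolding prime_to_def
proof (intro ballI allI impI)
  fix t y assume t: "t \<in> S" and "t dvd b * y"
  note this(2)
  also have "b * y dvd a * y"
    using assms(2) by (simp add: mult_dvd_mono)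
  finally show "t dvd y"
    by (rule prime_toD[OF assms(1) t])
qed

lemma mem_principal_ideal: "x \<in> principal_ideal a \<longleftrightarrow> a dvd x"
  by (auto simp: principal_ideal_def dvd_def)

text \<open>A common multiple of \<open>a\<close> and \<open>t\<close> is some \<open>a * y\<close>
  with \<open>t dvd a * y\<close>; that it is a multiple of \<open>a * t\<close> means
  \<open>t dvd y\<close>, by cancelling \<open>a \<noteq> 0\<close> in the domain.\<close>

lemma principal_ideal_Int_eq_iff_prime_to:
  fixes a :: "'a::idom"
  assumes "a \<noteq> 0"
  shows "(\<forall>t\<in>S. principal_ideal a \<inter> principal_ideal t = principal_ideal (a * t)) \<longleftrightarrow>
    prime_to S a"
proof -
  have "principal_ideal a \<inter> principal_ideal t = principal_ideal (a * t) \<longleftrightarrow>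
      (\<forall>y. t dvd a * y \<longrightarrow> t dvd y)" for t
  proof -
    have "principal_ideal a \<inter> principal_ideal t = principal_ideal (a * t) \<longleftrightarrow>
        (\<forall>x. a dvd x \<and> t dvd x \<longleftrightarrow> a * t dvd x)"
      by (auto simp: set_eq_iff mem_principal_ideal)
    also have "\<dots> \<longleftrightarrow> (\<forall>x. a dvd x \<and> t dvd x \<longrightarrow> a * t dvd x)"
      by (meson dvd_mult_left dvd_mult_right)
    also have "\<dots> \<longleftrightarrow> (\<forall>y. t dvd a * y \<longrightarrow> a * t dvd a * y)"
      by (auto simp: dvd_def[of a])
    finally show ?thesis
      using assms by simp
  qed
  then show ?thesis
    by (simp add: prime_to_def)
qed

lemma S_assoc_UNIV_iff: "S_assoc UNIV (*) a b \<longleftrightarrow> a dvd b \<and> b dvd a"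
proof -
  have "(\<exists>s. x = s * y) \<longleftrightarrow> y dvd x" for x y :: 'a
    unfolding dvd_def by (subst mult.commute) (rule refl)
  then show ?thesis
    unfolding S_assoc_def by (metis UNIV_I)
qed

text \<open>Taking \<open>y = 1\<close> shows that a divisor of \<open>a\<close> in \<open>S\<close>
  is a unit; its inverse lies in \<open>S\<close> by saturation, since their product is
  \<open>1\<close>.\<close>

lemma prime_to_imp_S_primitive:
  assumes S: "saturated_mult_set S" and a: "prime_to S a"
  shows "S_primitive S (*) a"
  unfolding S_primitive_def
proof (intro ballI allI impI)
  fix s n assume s: "s \<in> S" and eq: "a = s * n"
  have "s dvd 1"
    using prime_toD[OF a s, of 1] eq by simp
  then obtain u where u: "1 = s * u" by (elim dvdE)
  with S have "u \<in> S" unfolding saturated_mult_set_def by metis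
  moreover have "n = u * a"
    using eq u by (metis mult.assoc mult.commute mult_1)
  ultimately show "S_assoc S (*) n a"
    using s eq unfolding S_assoc_def by blast
qed

lemma splitting_mult_set_factorization:
  fixes S :: "'a::idom set"
  assumes "splitting_mult_set S" "x \<noteq> 0"
  obtains a s where "s \<in> S" "x = s * a" "prime_to S a"
proof -
  obtain a s where *: "s \<in> S" "x = a * s"
      "\<forall>t\<in>S. principal_ideal a \<inter> principal_ideal t = principal_ideal (a * t)"
    using assms(1) unfolding splitting_mult_set_def by blast
  with assms(2) have "prime_to S a"
    by (subst principal_ideal_Int_eq_iff_prime_to[symmetric]) auto
  then show thesis
    using that[of s a] *(1,2) by (simp add: mult.commute)
qed

text \<open>Primitivity makes \<open>x\<close> associated to its part prime to \<open>S\<close>, and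
  being prime to \<open>S\<close> passes to divisors.\<close>

lemma splitting_mult_set_primitive_imp_prime_to:
  fixes S :: "'a::idom set"
  assumes S: "splitting_mult_set S" and x: "x \<noteq> 0" "S_primitive S (*) x"
  shows "prime_to S x"
proof -
  obtain a s where a: "s \<in> S" "x = s * a" "prime_to S a"
    using splitting_mult_set_factorization[OF S x(1)] .
  then have "S_assoc S (*) a x"
    using x(2) unfolding S_primitive_def by blast
  then have "x dvd a"
    unfolding S_assoc_def by (metis dvd_triv_right)
  with a(3) show ?thesis by (rule prime_to_dvd)
qed

lemma splitting_mult_set_imp_splits:
  fixes S :: "'a::idom set"
  assumes S: "splitting_mult_set S"
  shows "splits S (*) (UNIV :: 'a set)"
proof -
  have sat: "saturated_mult_set S"
    using S by (simp add: splitting_mult_set_def)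
  note prime_to = splitting_mult_set_primitive_imp_prime_to[OF S]
  have "compactly_S_atomic S (*) (UNIV :: 'a set)"
    unfolding compactly_S_atomic_def compact_S_atomic_factorization_def
    using splitting_mult_set_factorization[OF S] prime_to_imp_S_primitive[OF sat] by blast
  moreover have dvd: "s dvd s'"
    if "m \<noteq> 0" "compact_S_atomic_factorization S (*) m s n"
      "compact_S_atomic_factorization S (*) m s' n'" for m s n s' n' :: 'a
  proof -
    have m: "m = s * n" "s \<in> S" "m = s' * n'" "S_primitive S (*) n'"
      using that(2,3) unfolding compact_S_atomic_factorization_def by blast+
    with that(1) have "prime_to S n'"
      by (intro prime_to) auto
    moreover have "s dvd n' * s'"
      using m(1,3) by (metis dvd_triv_left mult.commute)
    ultimately show ?thesis
      using m(2) by (blast dest: prime_toD)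
  qed
  have "S_assoc UNIV (*) s s'"
    if "m \<noteq> 0" "compact_S_atomic_factorization S (*) m s n"
      "compact_S_atomic_factorization S (*) m s' n'" for m s n s' n' :: 'a
    using dvd[OF that] dvd[OF that(1,3,2)] by (simp add: S_assoc_UNIV_iff)
  moreover have "S_primitive S (*) (r * m)"
    if "S_primitive S (*) r" "S_primitive S (*) m" "r * m \<noteq> 0" for r m
  proof -
    have "prime_to S r" "prime_to S m"
      using that by (auto intro: prime_to)
    then show ?thesis
      by (intro prime_to_imp_S_primitive[OF sat] prime_to_mult)
  qed
  ultimately show ?thesis
    unfolding splits_def semi_S_factorable_def by blast
qed

lemma splits_primitive_imp_prime_to:
  fixes S :: "'a::idom set"
  assumes sat: "saturated_mult_set S" and spl: "splits S (*) (UNIV :: 'a set)"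
    and n: "n \<noteq> 0" "S_primitive S (*) n"
  shows "prime_to S n"
  unfolding prime_to_def
proof (intro ballI allI impI)
  fix t y assume t: "t \<in> S" and "t dvd n * y"
  then obtain z where z: "n * y = t * z" by (elim dvdE)
  have factor: "\<exists>s a. x = s * a \<and> s \<in> S \<and> S_primitive S (*) a" if "x \<noteq> 0" for x
    using spl that unfolding splits_def semi_S_factorable_def compactly_S_atomic_def
      compact_S_atomic_factorization_def by blast
  show "t dvd y"
  \<comment> \<open>Only nonzero elements are known to have compact factorizations.\<close>
  proof (cases "y = 0")
    case False
    with n z have "z \<noteq> 0" by auto
    obtain u y' where y: "y = u * y'" "u \<in> S" "S_primitive S (*) y'"
      using factor[OF False] by blast
    obtain v z' where z': "z = v * z'" "v \<in> S" "S_primitive S (*) z'"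
      using factor[OF \<open>z \<noteq> 0\<close>] by blast
    have "n * y' \<noteq> 0" using n False y by simp
    \<comment> \<open>This is condition (2) of splitting; it lets \<open>u\<close> be the whole
      \<open>S\<close>-part of \<open>n * y\<close>.\<close>
    then have "S_primitive S (*) (n * y')"
      using spl n(2) y(3) unfolding splits_def by blast
    then have "compact_S_atomic_factorization S (*) (n * y) u (n * y')"
      using y by (simp add: compact_S_atomic_factorization_def mult.left_commute)
    moreover have "t * v \<in> S"
      using sat t z'(2) unfolding saturated_mult_set_def by blast
    then have "compact_S_atomic_factorization S (*) (n * y) (t * v) z'"
      using z z' by (simp add: compact_S_atomic_factorization_def mult.assoc)
    moreover have "n * y \<noteq> 0" using n False by simp
    ultimately have "S_assoc UNIV (*) (t * v) u"
      using spl unfolding splits_def semi_S_factorable_def by (meson UNIV_I)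
    then have "t dvd u"
      using S_assoc_UNIV_iff dvd_mult_left by blast
    then show ?thesis using y(1) by simp
  qed simp
qed

lemma splits_imp_splitting_mult_set:
  fixes S :: "'a::idom set"
  assumes sat: "saturated_mult_set S" and spl: "splits S (*) (UNIV :: 'a set)"
  shows "splitting_mult_set S"
  unfolding splitting_mult_set_def
proof (intro conjI allI sat)
  fix x
  show "\<exists>a s. s \<in> S \<and> x = a * s \<and>
      (\<forall>t\<in>S. principal_ideal a \<inter> principal_ideal t = principal_ideal (a * t))"
  \<comment> \<open>Splitting says nothing about \<open>0\<close>, but \<open>0 = 0 * 1\<close>
    works: both ideals to be compared are zero.\<close>
  proof (cases "x = 0")
    case True
    have "principal_ideal 0 \<inter> principal_ideal t = principal_ideal (0 * t)" for t :: 'a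
      by (auto simp: mem_principal_ideal)
    moreover have "1 \<in> S" using sat unfolding saturated_mult_set_def by blast
    ultimately show ?thesis
      using True by (intro exI[of _ 0] exI[of _ 1]) simp
  next
    case False
    then obtain s n where n: "x = s * n" "s \<in> S" "S_primitive S (*) n"
      using spl unfolding splits_def semi_S_factorable_def compactly_S_atomic_def
        compact_S_atomic_factorization_def by blast
    with False have "n \<noteq> 0" by auto
    then have "\<forall>t\<in>S. principal_ideal n \<inter> principal_ideal t = principal_ideal (n * t)"
      using splits_primitive_imp_prime_to[OF sat spl] n(3)
      by (simp add: principal_ideal_Int_eq_iff_prime_to)
    moreover have "x = n * s"
      using n(1) by (simp only: mult.commute)
    ultimately show ?thesis using n(2) by blast
  qed
qed

theorem theorem3p8:
  fixes S :: "'a::idom set"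
  assumes "saturated_mult_set S"
  shows "splitting_mult_set S \<longleftrightarrow> splits S (*) (UNIV :: 'a set)"
  using splitting_mult_set_imp_splits splits_imp_splitting_mult_set[OF assms] by blast

end
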